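(* Let $X$ be a compact metric space, let $f\colon X\to X$ be a continuous map, and let $x\in X$ be a shadowable point for $f$ (i.e. $x\in Sh(f)$). Then the following conditions are equivalent: (a) $x\in LSC(\omega_f)$, i.e. the set-valued map $\omega_f$ is lower semicontinuous at $x$; (b) $\omega_f(x)\subset\omega_f(y)$ for all $y\in\Omega_f(x)$ (and so, in this case, $\omega_f(x)$ is a minimal set for $f$).
   Context: $(X,d)$ is a compact metric space, $f\colon X\to X$ is continuous, and $\mathcal{K}(X)$ is the set of non-empty closed subsets of $X$. $\omega_f(x)$ is the set of $y\in X$ such that $\lim_{j\to\infty}f^{i_j}(x)=y$ for some $0\le i_1<i_2<\cdots$; $\omega_f$ is regarded as a map $X\to\mathcal{K}(X)$. $\Omega_f(x)$ is the set of $y\in X$ for which there are $x_j\in X$, $j\ge1$, and $0\le i_1<i_2<\cdots$ with $\lim_{j\to\infty}x_j=x$ and $\lim_{j\to\infty}f^{i_j}(x_j)=y$. A map $\phi\colon X\to\mathcal{K}(X)$ is lower semicontinuous at $x$ if for every open $U\subset X$ with $\phi(x)\cap U\ne\emptyset$ there is $\delta>0$ such that $d(x,y)\le\delta$ implies $\phi(y)\cap U\ne\emptyset$ for all $y\in X$. $LSC(\phi)$ is the set of lower semicontinuity points of $\phi$. A non-empty closed set $M\subset X$ with $f(M)\subset M$ is a minimal set for $f$ if $M=\omega_f(x)$ for all $x\in M$. For $\delta>0$, a sequence $(x_i)_{i\ge0}$ in $X$ is a $\delta$-pseudo orbit of $f$ if $\sup_{i\ge0}d(f(x_i),x_{i+1})\le\delta$;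 it is $\epsilon$-shadowed by $y\in X$ if $\sup_{i\ge0}d(x_i,f^i(y))\le\epsilon$. A point $x\in X$ is shadowable for $f$ if for every $\epsilon>0$ there is $\delta>0$ such that every $\delta$-pseudo orbit $(x_i)_{i\ge0}$ of $f$ with $x_0=x$ is $\epsilon$-shadowed by some $y\in X$. $Sh(f)$ is the set of shadowable points. *)

theory Defs
  imports "HOL-Analysis.Analysis"
begin

text \<open>
  The space is a compact subset \<open>X\<close> of an ambient metric type, with the restricted metric; all
  notions are relative to \<open>X\<close>. A map of the space is a function with \<open>f ` X \<subseteq> X\<close> whose values
  outside \<open>X\<close> are irrelevant.
\<close>

definition nonempty_closed_subsets :: "'a::metric_space set \<Rightarrow> 'a set set"
  where "nonempty_closed_subsets X = {C. C \<noteq> {} \<and> closedin (top_of_set X) C}"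

definition omega_limit :: "'a::metric_space set \<Rightarrow> ('a \<Rightarrow> 'a) \<Rightarrow> 'a \<Rightarrow> 'a set"
  where "omega_limit X f x =
    {y \<in> X. \<exists>i :: nat \<Rightarrow> nat. strict_mono i \<and> (\<lambda>j. (f ^^ i j) x) \<longlonglongrightarrow> y}"

definition Omega_limit :: "'a::metric_space set \<Rightarrow> ('a \<Rightarrow> 'a) \<Rightarrow> 'a \<Rightarrow> 'a set"
  where "Omega_limit X f x =
    {y \<in> X. \<exists>(z :: nat \<Rightarrow> 'a) (i :: nat \<Rightarrow> nat). range z \<subseteq> X \<and> strict_mono i \<and>
        z \<longlonglongrightarrow> x \<and> (\<lambda>j. (f ^^ i j) (z j)) \<longlonglongrightarrow> y}"

definition LSC :: "'a::metric_space set \<Rightarrow> ('a \<Rightarrow> 'a set) \<Rightarrow> 'a set"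
  where "LSC X \<phi> =
    {x \<in> X. \<forall>U. openin (top_of_set X) U \<and> \<phi> x \<inter> U \<noteq> {} \<longrightarrow>
        (\<exists>\<delta>>0. \<forall>y\<in>X. dist x y \<le> \<delta> \<longrightarrow> \<phi> y \<inter> U \<noteq> {})}"

definition minimal_set :: "'a::metric_space set \<Rightarrow> ('a \<Rightarrow> 'a) \<Rightarrow> 'a set \<Rightarrow> bool"
  where "minimal_set X f M \<longleftrightarrow>
    M \<in> nonempty_closed_subsets X \<and> f ` M \<subseteq> M \<and> (\<forall>x\<in>M. M = omega_limit X f x)"

definition pseudo_orbit :: "'a::metric_space set \<Rightarrow> ('a \<Rightarrow> 'a) \<Rightarrow> real \<Rightarrow> (nat \<Rightarrow> 'a) \<Rightarrow> bool"
  where "pseudo_orbit X f \<delta> \<xi> \<longleftrightarrow> range \<xi> \<subseteq> X \<and> (\<forall>i. dist (f (\<xi> i)) (\<xi> (Suc i)) \<le> \<delta>)"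

definition shadowed_by :: "('a::metric_space \<Rightarrow> 'a) \<Rightarrow> real \<Rightarrow> (nat \<Rightarrow> 'a) \<Rightarrow> 'a \<Rightarrow> bool"
  where "shadowed_by f \<epsilon> \<xi> y \<longleftrightarrow> (\<forall>i. dist (\<xi> i) ((f ^^ i) y) \<le> \<epsilon>)"

definition Sh :: "'a::metric_space set \<Rightarrow> ('a \<Rightarrow> 'a) \<Rightarrow> 'a set"
  where "Sh X f =
    {x \<in> X. \<forall>\<epsilon>>0. \<exists>\<delta>>0. \<forall>\<xi>. pseudo_orbit X f \<delta> \<xi> \<and> \<xi> 0 = x \<longrightarrow>
        (\<exists>y\<in>X. shadowed_by f \<epsilon> \<xi> y)}"

lemma funpow_in_invariant:
  assumes "f ` X \<subseteq> X" and "x \<in> X"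
  shows "(f ^^ n) x \<in> X"
  using assms by (induction n) auto

lemma omega_limit_iff_frequently:
  "y \<in> omega_limit X f x \<longleftrightarrow>
     y \<in> X \<and> (\<forall>e>0. \<forall>N. \<exists>n\<ge>N. dist ((f ^^ n) x) y < e)"  (is "_ \<longleftrightarrow> _ \<and> ?F")
proof -
  have "?F" if i: "strict_mono i" and l: "(\<lambda>j. (f ^^ i j) x) \<longlonglongrightarrow> y" for i :: "nat \<Rightarrow> nat"
  proof (intro allI impI)
    fix e :: real and N assume "e > 0"
    then obtain K where K: "\<And>j. j \<ge> K \<Longrightarrow> dist ((f ^^ i j) x) y < e"
      using l unfolding lim_sequentially by blast
    have "i (max K N) \<ge> N"
      using seq_suble[OF i, of "max K N"] by linarith
    with K[of "max K N"] show "\<exists>n\<ge>N. dist ((f ^^ n) x) y < e" by auto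
  qed
  moreover have "\<exists>i :: nat \<Rightarrow> nat. strict_mono i \<and> (\<lambda>j. (f ^^ i j) x) \<longlonglongrightarrow> y" if F: ?F
  proof -
    have "\<exists>i. \<forall>n. dist ((f ^^ i n) x) y < 1 / real (Suc n) \<and> i n < i (Suc n)"
    proof (rule dependent_nat_choice)
      show "\<exists>m. dist ((f ^^ m) x) y < 1 / real (Suc 0)"
        using F[rule_format, of 1 0] by simp
      show "\<exists>m'. dist ((f ^^ m') x) y < 1 / real (Suc (Suc n)) \<and> m < m'" for m n
        using F[rule_format, of "1 / real (Suc (Suc n))" "Suc m"] by (auto simp: Suc_le_eq)
    qed
    then obtain i where i: "\<And>n. dist ((f ^^ i n) x) y < 1 / real (Suc n)"
      and "\<And>n. i n < i (Suc n)" by blast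
    then have "strict_mono i" by (simp add: strict_mono_Suc_iff)
    moreover have "(\<lambda>n. dist ((f ^^ i n) x) y) \<longlonglongrightarrow> 0"
    proof (rule tendsto_sandwich[where f = "\<lambda>_. 0"])
      show "(\<lambda>n. 1 / real (Suc n)) \<longlonglongrightarrow> 0"
        using LIMSEQ_inverse_real_of_nat by (simp add: inverse_eq_divide)
      show "\<forall>\<^sub>F n in sequentially. dist ((f ^^ i n) x) y \<le> 1 / real (Suc n)"
        using i less_imp_le by (intro always_eventually) blast
    qed auto
    ultimately show ?thesis using tendsto_dist_iff[of "\<lambda>n. (f ^^ i n) x"] by blast
  qed
  ultimately show ?thesis unfolding omega_limit_def by blast
qed

lemma omega_limit_in_nonempty_closed_subsets:
  assumes X: "compact X" and f: "f ` X \<subseteq> X" and x: "x \<in> X"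
  shows "omega_limit X f x \<in> nonempty_closed_subsets X"
proof -
  have "\<forall>n. (f ^^ n) x \<in> X"
    using funpow_in_invariant[OF f x] by blast
  then obtain l r where "l \<in> X" "strict_mono r" "((\<lambda>n. (f ^^ n) x) \<circ> r) \<longlonglongrightarrow> l"
    using X[unfolded compact_def, rule_format, of "\<lambda>n. (f ^^ n) x"] by auto
  then have "l \<in> omega_limit X f x"
    unfolding omega_limit_def o_def by blast
  moreover have "closed (omega_limit X f x)"
    unfolding closed_sequential_limits
  proof (intro allI impI, elim conjE)
    fix s y assume s: "\<forall>n. s n \<in> omega_limit X f x" and y: "s \<longlonglongrightarrow> y"
    have "y \<in> X"
    proof (rule closed_sequentially[OF compact_imp_closed[OF X] _ y])
      show "s n \<in> X" for n
        using s[rule_format, of n] by (simp add: omega_limit_def)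
    qed
    moreover have "\<exists>n\<ge>N. dist ((f ^^ n) x) y < e" if "e > 0" for e N
    proof -
      obtain k where k: "dist (s k) y < e / 2"
        using metric_LIMSEQ_D[OF y, of "e / 2"] \<open>e > 0\<close> by auto
      obtain n where n: "n \<ge> N" "dist ((f ^^ n) x) (s k) < e / 2"
        using s[rule_format, of k, unfolded omega_limit_iff_frequently, THEN conjunct2,
            rule_format, of "e / 2" N] \<open>e > 0\<close> by auto
      have "dist ((f ^^ n) x) y < e"
        using k n(2) dist_triangle[of "(f ^^ n) x" y "s k"] by linarith
      with n(1) show ?thesis by blast
    qed
    ultimately show "y \<in> omega_limit X f x"
      unfolding omega_limit_iff_frequently by blast
  qed
  moreover have "omega_limit X f x \<subseteq> X"
    unfolding omega_limit_def by blast
  ultimately show ?thesis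
    unfolding nonempty_closed_subsets_def by (auto intro: closed_subset)
qed

end

theory Submission
  imports Defs
begin

text \<open>
  If \<open>\<omega>\<close> is lower semicontinuous at \<open>x\<close> and \<open>y \<in> \<Omega>(x)\<close>, the sequence that starts at \<open>x\<close>, follows the
  orbit of a point near \<open>x\<close> until it comes close to \<open>y\<close> and then follows the orbit of \<open>y\<close> is a pseudo
  orbit. A point \<open>w\<close> shadowing it is close to \<open>x\<close>, so \<open>\<omega>(w)\<close> comes close to any given \<open>p \<in> \<omega>(x)\<close>;
  since the orbit of \<open>w\<close> finally stays close to that of \<open>y\<close>, so does \<open>\<omega>(y)\<close>.
  Conversely, if \<open>z\<^sub>j \<rightarrow> x\<close> and every \<open>\<omega>(z\<^sub>j)\<close> misses an open set \<open>U\<close> that meets \<open>\<omega>(x)\<close>, then a limit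
  \<open>y\<close> of points \<open>y\<^sub>j \<in> \<omega>(z\<^sub>j)\<close> lies in \<open>\<Omega>(x)\<close>, so the orbit of \<open>y\<close> enters \<open>U\<close>; by continuity so does
  the orbit of some \<open>y\<^sub>j\<close>, which stays in \<open>\<omega>(z\<^sub>j)\<close>.
\<close>

lemma continuous_on_funpow:
  fixes f :: "'a::topological_space \<Rightarrow> 'a"
  assumes "continuous_on X f" and "f ` X \<subseteq> X"
  shows "continuous_on X (f ^^ n)"
proof (induction n)
  case (Suc n)
  have "(f ^^ n) ` X \<subseteq> X"
    using funpow_in_invariant[OF assms(2)] by blast
  then have "continuous_on ((f ^^ n) ` X) f"
    using assms(1) continuous_on_subset by blast
  with Suc show ?case
    unfolding funpow.simps by (rule continuous_on_compose)
qed (simp add: id_def)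

lemma LIMSEQ_dist_le_inverse_Suc:
  fixes z :: "nat \<Rightarrow> 'a::metric_space"
  assumes "\<And>k. dist (z k) x \<le> inverse (real (Suc k))"
  shows "z \<longlonglongrightarrow> x"
proof -
  have "(\<lambda>k. dist (z k) x) \<longlonglongrightarrow> 0"
    by (rule tendsto_sandwich[OF _ _ tendsto_const LIMSEQ_inverse_real_of_nat])
      (use assms in \<open>auto simp del: of_nat_Suc\<close>)
  then show ?thesis
    using tendsto_dist_iff by blast
qed

lemma omega_limit_funpow_closed:
  assumes f: "continuous_on X f" "f ` X \<subseteq> X" and x: "x \<in> X" and y: "y \<in> omega_limit X f x"
  shows "(f ^^ n) y \<in> omega_limit X f x"
proof -
  obtain i where i: "strict_mono i" "(\<lambda>j. (f ^^ i j) x) \<longlonglongrightarrow> y" and "y \<in> X"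
    using y unfolding omega_limit_def by blast
  have "(\<lambda>j. (f ^^ n) ((f ^^ i j) x)) \<longlonglongrightarrow> (f ^^ n) y"
    using continuous_on_tendsto_compose[OF continuous_on_funpow[OF f] i(2) \<open>y \<in> X\<close>]
      funpow_in_invariant[OF f(2) x] by simp
  then have "(\<lambda>j. (f ^^ (n + i j)) x) \<longlonglongrightarrow> (f ^^ n) y"
    by (simp add: funpow_add)
  moreover have "strict_mono (\<lambda>j. n + i j)"
    using i(1) by (simp add: strict_mono_def)
  ultimately show ?thesis
    using funpow_in_invariant[OF f(2) \<open>y \<in> X\<close>, of n] unfolding omega_limit_def by blast
qed

text \<open>The whole forward orbit of \<open>y\<close> lies in \<open>omega_limit X f x\<close>,
  and that set is closed, so it also contains every limit along this orbit.\<close>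

lemma omega_limit_mono:
  assumes X: "compact X" and f: "continuous_on X f" "f ` X \<subseteq> X"
    and x: "x \<in> X" and y: "y \<in> omega_limit X f x"
  shows "omega_limit X f y \<subseteq> omega_limit X f x"
proof
  fix p assume "p \<in> omega_limit X f y"
  then obtain i where i: "(\<lambda>j. (f ^^ i j) y) \<longlonglongrightarrow> p"
    unfolding omega_limit_def by blast
  have "closed (omega_limit X f x)"
    using omega_limit_in_nonempty_closed_subsets[OF X f(2) x] compact_imp_closed[OF X]
    unfolding nonempty_closed_subsets_def by (auto intro: closedin_closed_trans)
  then show "p \<in> omega_limit X f x"
    using omega_limit_funpow_closed[OF f x y] i by (rule closed_sequentially)
qed

text \<open>The constant sequence at \<open>x\<close> serves as the perturbation.\<close>

lemma omega_limit_subset_Omega_limit: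
  assumes "x \<in> X"
  shows "omega_limit X f x \<subseteq> Omega_limit X f x"
proof
  fix y assume "y \<in> omega_limit X f x"
  then obtain i where "y \<in> X" "strict_mono i" "(\<lambda>j. (f ^^ i j) x) \<longlonglongrightarrow> y"
    unfolding omega_limit_def by blast
  then show "y \<in> Omega_limit X f x"
    using assms unfolding Omega_limit_def
    by (auto intro!: exI[of _ "\<lambda>_. x"] exI[of _ i])
qed

text \<open>Replaces the pair of sequences by a single choice of time and point for each tolerance,
  the form in which both directions of the equivalence use \<Omega>.\<close>

lemma Omega_limit_iff_frequently:
  "y \<in> Omega_limit X f x \<longleftrightarrow>
     y \<in> X \<and> (\<forall>e>0. \<forall>N. \<exists>n\<ge>N. \<exists>z\<in>X. dist z x < e \<and> dist ((f ^^ n) z) y < e)"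
  (is "_ \<longleftrightarrow> _ \<and> ?F")
proof -
  have "?F" if i: "strict_mono i" and z: "range z \<subseteq> X" "z \<longlonglongrightarrow> x"
    and l: "(\<lambda>j. (f ^^ i j) (z j)) \<longlonglongrightarrow> y" for i :: "nat \<Rightarrow> nat" and z
  proof (intro allI impI)
    fix e :: real and N assume "e > 0"
    then have "\<forall>\<^sub>F j in sequentially. dist (z j) x < e \<and> dist ((f ^^ i j) (z j)) y < e \<and> j \<ge> N"
      using z(2) l by (intro eventually_conj) (auto intro: tendstoD eventually_ge_at_top)
    then obtain j where j: "dist (z j) x < e" "dist ((f ^^ i j) (z j)) y < e" "j \<ge> N"
      using eventually_happens trivial_limit_sequentially by blast
    moreover have "i j \<ge> N"
      using seq_suble[OF i, of j] j(3) by linarith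
    ultimately show "\<exists>n\<ge>N. \<exists>z\<in>X. dist z x < e \<and> dist ((f ^^ n) z) y < e"
      using z(1) by blast
  qed
  moreover have "\<exists>z i. range z \<subseteq> X \<and> strict_mono i \<and> z \<longlonglongrightarrow> x \<and> (\<lambda>j. (f ^^ i j) (z j)) \<longlonglongrightarrow> y"
    if F: ?F
  proof -
    define P where "P k m z \<longleftrightarrow> z \<in> X \<and> dist z x < inverse (real (Suc k)) \<and>
      dist ((f ^^ m) z) y < inverse (real (Suc k))" for k m z
    have ex: "\<exists>m\<ge>N. \<exists>z. P k m z" for k N
      using F[rule_format, of "inverse (real (Suc k))" N] unfolding P_def by auto
    \<comment> \<open>Only the times are tied together, by monotonicity, so the recursion runs over
      them alone; the points are picked afterwards.\<close>
    have "\<exists>i. \<forall>k. (\<exists>z. P k (i k) z) \<and> i k < i (Suc k)"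
    proof (rule dependent_nat_choice)
      show "\<exists>m. \<exists>z. P 0 m z"
        using ex by blast
      show "\<exists>m'. (\<exists>z. P (Suc k) m' z) \<and> m < m'" for m k
        using ex[of "Suc m" "Suc k"] by (auto simp: Suc_le_eq)
    qed
    then obtain i z where P: "\<And>k. P k (i k) (z k)" and "\<And>k. i k < i (Suc k)"
      by metis
    then have "strict_mono i" by (simp add: strict_mono_Suc_iff)
    have "z \<longlonglongrightarrow> x" "(\<lambda>k. (f ^^ i k) (z k)) \<longlonglongrightarrow> y"
      using P unfolding P_def by (auto intro!: LIMSEQ_dist_le_inverse_Suc less_imp_le)
    then show ?thesis
      using P \<open>strict_mono i\<close> unfolding P_def by blast
  qed
  ultimately show ?thesis unfolding Omega_limit_def by blast
qed

text \<open>Points of \<omega>(x) belong to \<Omega>(x), so \<open>sub\<close> gives one inclusion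
  between \<omega>(x) and \<omega>(y); monotonicity of \<omega> gives the other.\<close>

lemma minimal_set_omega_limit:
  assumes X: "compact X" and f: "continuous_on X f" "f ` X \<subseteq> X" and x: "x \<in> X"
    and sub: "\<And>y. y \<in> Omega_limit X f x \<Longrightarrow> omega_limit X f x \<subseteq> omega_limit X f y"
  shows "minimal_set X f (omega_limit X f x)"
  unfolding minimal_set_def
proof (intro conjI ballI)
  show "omega_limit X f x \<in> nonempty_closed_subsets X"
    by (rule omega_limit_in_nonempty_closed_subsets[OF X f(2) x])
  show "f ` omega_limit X f x \<subseteq> omega_limit X f x"
    using omega_limit_funpow_closed[OF f x, of _ 1] by auto
  show "omega_limit X f x = omega_limit X f y" if "y \<in> omega_limit X f x" for y
    using sub omega_limit_mono[OF X f x that] omega_limit_subset_Omega_limit[OF x] that by blast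
qed

lemma LSC_omega_limitI:
  assumes X: "compact X" and f: "continuous_on X f" "f ` X \<subseteq> X" and x: "x \<in> X"
    and sub: "\<And>y. y \<in> Omega_limit X f x \<Longrightarrow> omega_limit X f x \<subseteq> omega_limit X f y"
  shows "x \<in> LSC X (omega_limit X f)"
  unfolding LSC_def mem_Collect_eq
proof (intro conjI allI impI x, elim conjE, rule ccontr)
  fix U
  assume U: "openin (top_of_set X) U" "omega_limit X f x \<inter> U \<noteq> {}"
    and "\<not> (\<exists>\<delta>>0. \<forall>z\<in>X. dist x z \<le> \<delta> \<longrightarrow> omega_limit X f z \<inter> U \<noteq> {})"
  then have miss: "\<exists>z\<in>X. dist x z \<le> \<delta> \<and> omega_limit X f z \<inter> U = {}" if "\<delta> > 0" for \<delta>
    using that by meson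
  have "\<exists>z\<in>X. dist x z \<le> inverse (real (Suc k)) \<and> omega_limit X f z \<inter> U = {}" for k
    by (rule miss) simp
  then obtain z where z: "\<And>k. z k \<in> X" "\<And>k. dist x (z k) \<le> inverse (real (Suc k))"
      "\<And>k. omega_limit X f (z k) \<inter> U = {}"
    by metis
  have zx: "z \<longlonglongrightarrow> x"
    using z(2) by (intro LIMSEQ_dist_le_inverse_Suc) (metis dist_commute)
  have "\<exists>y. y \<in> omega_limit X f (z k)" for k
    using omega_limit_in_nonempty_closed_subsets[OF X f(2) z(1)[of k]]
    unfolding nonempty_closed_subsets_def by blast
  then obtain y where y: "\<And>k. y k \<in> omega_limit X f (z k)"
    by metis
  then have yX: "y k \<in> X" for k
    unfolding omega_limit_def by blast
  then obtain l r where l: "l \<in> X" and r: "strict_mono r" and yl: "(y \<circ> r) \<longlonglongrightarrow> l"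
    using X[unfolded compact_def, rule_format, of y] by auto
  have zr: "(z \<circ> r) \<longlonglongrightarrow> x"
    by (rule LIMSEQ_subseq_LIMSEQ[OF zx r])
  \<comment> \<open>Diagonal choice: first fix \<open>k\<close> with \<open>z (r k)\<close> near
    \<open>x\<close> and \<open>y (r k)\<close> near \<open>l\<close>, then a late time at which the
    orbit of \<open>z (r k)\<close> is near \<open>y (r k)\<close>.\<close>
  have "l \<in> Omega_limit X f x"
    unfolding Omega_limit_iff_frequently
  proof (intro conjI allI impI l)
    fix e :: real and N assume e: "e > 0"
    then have "\<forall>\<^sub>F k in sequentially. dist ((z \<circ> r) k) x < e \<and> dist ((y \<circ> r) k) l < e / 2"
      by (intro eventually_conj tendstoD[OF zr] tendstoD[OF yl]) auto
    then obtain k where k: "dist (z (r k)) x < e" "dist (y (r k)) l < e / 2"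
      using eventually_happens trivial_limit_sequentially by fastforce
    obtain n where n: "n \<ge> N" "dist ((f ^^ n) (z (r k))) (y (r k)) < e / 2"
      using y[of "r k"] e unfolding omega_limit_iff_frequently by (meson half_gt_zero)
    have "dist ((f ^^ n) (z (r k))) l < e"
      using k(2) n(2) dist_triangle[of "(f ^^ n) (z (r k))" l "y (r k)"] by linarith
    then show "\<exists>n\<ge>N. \<exists>z\<in>X. dist z x < e \<and> dist ((f ^^ n) z) l < e"
      using k(1) n(1) z(1) by blast
  qed
  then obtain p where p: "p \<in> omega_limit X f l" "p \<in> U"
    using sub U(2) by blast
  obtain T where T: "open T" "U = X \<inter> T"
    using U(1) by (auto simp: openin_open)
  obtain i where "(\<lambda>j. (f ^^ i j) l) \<longlonglongrightarrow> p"
    using p(1) unfolding omega_limit_def by blast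
  then have "\<forall>\<^sub>F j in sequentially. (f ^^ i j) l \<in> T"
    using T p(2) by (auto intro: topological_tendstoD)
  then obtain n where n: "(f ^^ n) l \<in> T"
    using eventually_happens trivial_limit_sequentially by blast
  \<comment> \<open>The time \<open>n\<close> is now fixed, so continuity of one iterate carries the
    visit to \<open>T\<close> from \<open>l\<close> over to nearby \<open>y (r k)\<close>.\<close>
  have "(\<lambda>k. (f ^^ n) ((y \<circ> r) k)) \<longlonglongrightarrow> (f ^^ n) l"
    using yX by (intro continuous_on_tendsto_compose[OF continuous_on_funpow[OF f] yl l]) auto
  then have "\<forall>\<^sub>F k in sequentially. (f ^^ n) ((y \<circ> r) k) \<in> T"
    using T(1) n by (rule topological_tendstoD)
  then obtain k where "(f ^^ n) (y (r k)) \<in> T"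
    using eventually_happens trivial_limit_sequentially by fastforce
  moreover have "(f ^^ n) (y (r k)) \<in> X"
    by (rule funpow_in_invariant[OF f(2) yX])
  moreover have "(f ^^ n) (y (r k)) \<in> omega_limit X f (z (r k))"
    by (rule omega_limit_funpow_closed[OF f z(1) y])
  ultimately show False
    using z(3)[of "r k"] T(2) by blast
qed

text \<open>The bound \<open>2 \<le> m\<close> keeps the jump out of \<open>x\<close> and the jump onto \<open>y\<close> in separate steps.\<close>

lemma pseudo_orbit_splice:
  assumes f: "f ` X \<subseteq> X" and "x \<in> X" "y \<in> X" "z \<in> X" and "\<delta> \<ge> 0" and "m \<ge> 2"
    and "dist (f x) (f z) \<le> \<delta>" and "dist ((f ^^ m) z) y \<le> \<delta>"
  shows "pseudo_orbit X f \<delta>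
    (\<lambda>k. if k = 0 then x else if k < m then (f ^^ k) z else (f ^^ (k - m)) y)"
  unfolding pseudo_orbit_def
proof (intro conjI allI)
  let ?\<xi> = "\<lambda>k. if k = 0 then x else if k < m then (f ^^ k) z else (f ^^ (k - m)) y"
  show "range ?\<xi> \<subseteq> X"
    using assms funpow_in_invariant[OF f] by auto
  fix k
  \<comment> \<open>In order: the jump from \<open>f x\<close> to \<open>f z\<close>, the orbit of
    \<open>z\<close>, the jump from \<open>(f ^^ m) z\<close> to \<open>y\<close>, the orbit of
    \<open>y\<close>. Only the two jumps have an error.\<close>
  consider "k = 0" | "k > 0" "Suc k < m" | "k > 0" "Suc k = m" | "k \<ge> m"
    by linarith
  then show "dist (f (?\<xi> k)) (?\<xi> (Suc k)) \<le> \<delta>"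
    by cases (use assms in \<open>auto simp: Suc_diff_le\<close>)
qed

lemma omega_limit_subset_of_LSC:
  assumes f: "continuous_on X f" "f ` X \<subseteq> X" and Sh: "x \<in> Sh X f"
    and lsc: "x \<in> LSC X (omega_limit X f)" and y: "y \<in> Omega_limit X f x"
  shows "omega_limit X f x \<subseteq> omega_limit X f y"
proof
  fix p assume p: "p \<in> omega_limit X f x"
  have x: "x \<in> X" and yX: "y \<in> X" and pX: "p \<in> X"
    using Sh y p unfolding Sh_def Omega_limit_def omega_limit_def by auto
  have "\<exists>n\<ge>N. dist ((f ^^ n) y) p < e" if e: "e > 0" for e N
  proof -
    have "openin (top_of_set X) (X \<inter> ball p (e / 3))"
      by (simp add: openin_open_Int)
    moreover have "p \<in> omega_limit X f x \<inter> (X \<inter> ball p (e / 3))"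
      using p pX e by simp
    ultimately have "\<exists>\<eta>>0. \<forall>w\<in>X. dist x w \<le> \<eta> \<longrightarrow>
        omega_limit X f w \<inter> (X \<inter> ball p (e / 3)) \<noteq> {}"
      using lsc[unfolded LSC_def, simplified, THEN conjunct2, THEN spec, of "X \<inter> ball p (e / 3)"]
      by blast
    then obtain \<eta> where \<eta>: "\<eta> > 0"
      and near: "\<And>w. w \<in> X \<Longrightarrow> dist x w \<le> \<eta> \<Longrightarrow> omega_limit X f w \<inter> (X \<inter> ball p (e / 3)) \<noteq> {}"
      by blast
    \<comment> \<open>The bound \<eta> puts the shadowing point where lower semicontinuity applies;
      \<open>e / 3\<close> is its share of the final triangle inequality.\<close>
    define \<epsilon> where "\<epsilon> = min \<eta> (e / 3)"
    have "\<epsilon> > 0"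
      using \<eta> e by (simp add: \<epsilon>_def)
    then obtain \<delta> where \<delta>: "\<delta> > 0"
      and shadow: "\<And>\<xi>. pseudo_orbit X f \<delta> \<xi> \<Longrightarrow> \<xi> 0 = x \<Longrightarrow> \<exists>w\<in>X. shadowed_by f \<epsilon> \<xi> w"
      using Sh unfolding Sh_def by blast
    obtain \<gamma> where \<gamma>: "\<gamma> > 0" "\<And>z. z \<in> X \<Longrightarrow> dist z x < \<gamma> \<Longrightarrow> dist (f z) (f x) < \<delta>"
      using f(1) x \<delta> unfolding continuous_on_iff by meson
    \<comment> \<open>One tolerance for both jumps: \<gamma> controls the step out of
      \<open>x\<close> by continuity of \<open>f\<close>, \<delta> the step onto
      \<open>y\<close>.\<close>
    have "min \<gamma> \<delta> > 0"
      using \<gamma>(1) \<delta> by simp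
    then obtain m z where m: "m \<ge> 2" and z: "z \<in> X" "dist z x < min \<gamma> \<delta>"
      and mz: "dist ((f ^^ m) z) y < min \<gamma> \<delta>"
      using y unfolding Omega_limit_iff_frequently by meson
    define \<xi> where
      "\<xi> k = (if k = 0 then x else if k < m then (f ^^ k) z else (f ^^ (k - m)) y)" for k
    have "dist (f x) (f z) \<le> \<delta>"
      using \<gamma>(2)[of z] z by (simp add: dist_commute)
    then have "pseudo_orbit X f \<delta> \<xi>"
      unfolding \<xi>_def using pseudo_orbit_splice[OF f(2) x yX z(1) _ m] \<delta> mz by simp
    then obtain w where w: "w \<in> X" and sh: "\<And>k. dist (\<xi> k) ((f ^^ k) w) \<le> \<epsilon>"
      using shadow[of \<xi>] unfolding shadowed_by_def by (auto simp: \<xi>_def)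
    have "dist x w \<le> \<eta>"
      using sh[of 0] by (simp add: \<xi>_def \<epsilon>_def)
    then obtain q where q: "q \<in> omega_limit X f w" "dist q p < e / 3"
      using near[OF w] by (auto simp: dist_commute)
    have "e / 3 > 0"
      using e by simp
    \<comment> \<open>From time \<open>m\<close> on, \<open>\<xi> n\<close> is
      \<open>(f ^^ (n - m)) y\<close>; the extra \<open>m\<close> keeps the shifted time at least
      \<open>N\<close>.\<close>
    then obtain n where n: "n \<ge> N + m" "dist ((f ^^ n) w) q < e / 3"
      using q(1) unfolding omega_limit_iff_frequently by blast
    have "dist ((f ^^ (n - m)) y) ((f ^^ n) w) \<le> e / 3"
      using sh[of n] n(1) m by (simp add: \<xi>_def \<epsilon>_def)
    then have "dist ((f ^^ (n - m)) y) p < e"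
      using n(2) q(2) dist_triangle[of "(f ^^ (n - m)) y" p "(f ^^ n) w"]
        dist_triangle[of "(f ^^ n) w" p q] by linarith
    moreover have "n - m \<ge> N"
      using n(1) by simp
    ultimately show ?thesis by blast
  qed
  with pX show "p \<in> omega_limit X f y"
    unfolding omega_limit_iff_frequently by blast
qed

theorem theorem3p1:
  fixes X :: "'a::metric_space set" and f :: "'a \<Rightarrow> 'a" and x :: 'a
  assumes "compact X"
    and "continuous_on X f"
    and "f ` X \<subseteq> X"
    and "x \<in> Sh X f"
  shows "(x \<in> LSC X (omega_limit X f) \<longleftrightarrow>
            (\<forall>y \<in> Omega_limit X f x. omega_limit X f x \<subseteq> omega_limit X f y)) \<and>
         ((\<forall>y \<in> Omega_limit X f x. omega_limit X f x \<subseteq> omega_limit X f y) \<longrightarrow>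
            minimal_set X f (omega_limit X f x))"
proof -
  have "x \<in> X"
    using assms(4) unfolding Sh_def by blast
  then show ?thesis
    using LSC_omega_limitI[OF assms(1-3)] minimal_set_omega_limit[OF assms(1-3)]
      omega_limit_subset_of_LSC[OF assms(2-4)] by blast
qed

end
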